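(* Let $G\neq\{1\}$ be a group that decomposes as an extension $$1\longrightarrow K\longrightarrow G\overset{\pi}{\longrightarrow}Q\longrightarrow 1$$ and let $\Theta:Q\to\mathrm{Out}(K)$ be the associated coupling. If (i) $FC_G(K)=\{1\}$, and (ii) $\Theta$ restricted to $FC(Q)$ is injective, then $G$ is icc.
   Context: A group is icc if it is infinite and all of its conjugacy classes except $\{1\}$ are infinite. $FC_G(K)$ is the set of elements of the normal subgroup $K$ whose $G$-conjugacy class is finite; $FC(Q)$ is the subgroup of elements of $Q$ with finite conjugacy class in $Q$. The coupling $\Theta$ sends $q\in Q$ to the class in $\mathrm{Out}(K)$ of the automorphism $x\mapsto gxg^{-1}$ of $K$, for any $g\in\pi^{-1}(q)$. *)

theory Defs
  imports "HOL-Algebra.Algebra"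
begin

definition conj_class :: "('a, 'm) monoid_scheme \<Rightarrow> 'a \<Rightarrow> 'a set" where
  "conj_class G x = (\<lambda>g. g \<otimes>\<^bsub>G\<^esub> x \<otimes>\<^bsub>G\<^esub> inv\<^bsub>G\<^esub> g) ` carrier G"

definition icc :: "('a, 'm) monoid_scheme \<Rightarrow> bool" where
  "icc G \<longleftrightarrow> infinite (carrier G) \<and> (\<forall>x \<in> carrier G - {\<one>\<^bsub>G\<^esub>}. infinite (conj_class G x))"

definition FC_in :: "('a, 'm) monoid_scheme \<Rightarrow> 'a set \<Rightarrow> 'a set" where
  "FC_in G K = {x \<in> K. finite (conj_class G x)}"

definition FC :: "('a, 'm) monoid_scheme \<Rightarrow> 'a set" where
  "FC G = FC_in G (carrier G)"

(* Automorphisms in HOL-Algebra are extensional functions, hence the restriction to S. *)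
definition conj_on :: "('a, 'm) monoid_scheme \<Rightarrow> 'a set \<Rightarrow> 'a \<Rightarrow> 'a \<Rightarrow> 'a" where
  "conj_on G S g = (\<lambda>x\<in>S. g \<otimes>\<^bsub>G\<^esub> x \<otimes>\<^bsub>G\<^esub> inv\<^bsub>G\<^esub> g)"

definition Inn :: "('a, 'm) monoid_scheme \<Rightarrow> ('a \<Rightarrow> 'a) set" where
  "Inn H = conj_on H (carrier H) ` carrier H"

definition Out :: "('a, 'm) monoid_scheme \<Rightarrow> ('a \<Rightarrow> 'a) set monoid" where
  "Out H = AutoGroup H Mod Inn H"

(* The value does not depend on the chosen preimage g of q: see coupling_eq below. *)
definition coupling ::
    "('a, 'm) monoid_scheme \<Rightarrow> 'a set \<Rightarrow> ('a \<Rightarrow> 'q) \<Rightarrow> 'q \<Rightarrow> ('a \<Rightarrow> 'a) set" where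
  "coupling G K \<pi> q =
     Inn (G\<lparr>carrier := K\<rparr>) #>\<^bsub>AutoGroup (G\<lparr>carrier := K\<rparr>)\<^esub>
       conj_on G K (SOME g. g \<in> carrier G \<and> \<pi> g = q)"

lemma mult_AutoGroup:
  assumes "f \<in> auto H" "g \<in> auto H"
  shows "f \<otimes>\<^bsub>AutoGroup H\<^esub> g = compose (carrier H) f g"
  using assms by (simp add: AutoGroup_def BijGroup_def auto_def)

lemma carrier_AutoGroup: "carrier (AutoGroup H) = auto H"
  by (simp add: AutoGroup_def)

lemma conj_on_auto:
  fixes G (structure)
  assumes "K \<lhd> G" "g \<in> carrier G"
  shows "conj_on G K g \<in> auto (G\<lparr>carrier := K\<rparr>)"
proof -
  interpret normal K G by fact
  have KG: "x \<in> carrier G" if "x \<in> K" for x using that subset by auto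
  have cl: "h \<otimes> x \<otimes> inv h \<in> K" if "h \<in> carrier G" "x \<in> K" for h x
    using that by (simp add: inv_op_closed2)
  have cl': "inv g \<otimes> x \<otimes> g \<in> K" if "x \<in> K" for x
    using that assms(2) by (simp add: inv_op_closed1)
  have c1: "inv g \<otimes> (g \<otimes> y) = y" and c2: "g \<otimes> (inv g \<otimes> y) = y" if "y \<in> carrier G" for y
    using that assms(2) by (simp_all flip: m_assoc)
  have "bij_betw (conj_on G K g) K K"
    by (rule bij_betw_byWitness[where f' = "\<lambda>x. inv g \<otimes> x \<otimes> g"])
       (use assms(2) cl cl' KG in \<open>auto simp: conj_on_def m_assoc c1 c2\<close>)
  moreover have "conj_on G K g \<in> hom (G\<lparr>carrier := K\<rparr>) (G\<lparr>carrier := K\<rparr>)"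
  proof (rule homI)
    fix x y assume "x \<in> carrier (G\<lparr>carrier := K\<rparr>)" "y \<in> carrier (G\<lparr>carrier := K\<rparr>)"
    then have xy: "x \<in> K" "y \<in> K" by auto
    have "g \<otimes> (x \<otimes> y) \<otimes> inv g = (g \<otimes> x \<otimes> inv g) \<otimes> (g \<otimes> y \<otimes> inv g)"
      using assms(2) KG xy by (simp add: m_assoc c1)
    then show "conj_on G K g (x \<otimes>\<^bsub>G\<lparr>carrier := K\<rparr>\<^esub> y)
        = conj_on G K g x \<otimes>\<^bsub>G\<lparr>carrier := K\<rparr>\<^esub> conj_on G K g y"
      using xy by (simp add: conj_on_def)
  qed (use assms(2) cl in \<open>auto simp: conj_on_def\<close>)
  ultimately show ?thesis
    by (auto simp: auto_def Bij_def conj_on_def)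
qed

lemma conj_on_mult:
  fixes G (structure)
  assumes "K \<lhd> G" "g \<in> carrier G" "h \<in> carrier G"
  shows "conj_on G K (g \<otimes>\<^bsub>G\<^esub> h) =
     conj_on G K g \<otimes>\<^bsub>AutoGroup (G\<lparr>carrier := K\<rparr>)\<^esub> conj_on G K h"
proof -
  interpret normal K G by fact
  have KG: "x \<in> carrier G" if "x \<in> K" for x using that subset by auto
  have "h \<otimes> x \<otimes> inv h \<in> K" if "x \<in> K" for x
    using that assms(3) by (simp add: inv_op_closed2)
  then have "conj_on G K (g \<otimes> h) = compose K (conj_on G K g) (conj_on G K h)"
    using assms(2,3) KG
    by (intro ext) (simp add: compose_def conj_on_def inv_mult_group m_assoc)
  then show ?thesis
    using mult_AutoGroup[OF conj_on_auto[OF assms(1,2)] conj_on_auto[OF assms(1,3)]] by simp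
qed

lemma Inn_subgroup_eq:
  fixes G (structure)
  assumes "K \<lhd> G"
  shows "Inn (G\<lparr>carrier := K\<rparr>) = conj_on G K ` K"
proof -
  interpret normal K G by fact
  show ?thesis
    unfolding Inn_def
    by (intro image_cong) (simp_all add: conj_on_def m_inv_consistent[OF subgroup_axioms])
qed

lemma Inn_normal:
  assumes "group H"
  shows "Inn H \<lhd> AutoGroup H"
proof -
  interpret H: group H by fact
  interpret A: group "AutoGroup H" by (rule H.AutoGroup)
  have nrm: "carrier H \<lhd> H"
    by (rule H.normal_invI[OF H.subgroup_self]) simp
  have hm: "conj_on H (carrier H) \<in> hom H (AutoGroup H)"
    using conj_on_auto[OF nrm] conj_on_mult[OF nrm]
    by (intro homI) (auto simp: carrier_AutoGroup)
  interpret h: group_hom H "AutoGroup H" "conj_on H (carrier H)"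
    using hm by unfold_locales
  have sg: "subgroup (Inn H) (AutoGroup H)"
    unfolding Inn_def by (rule h.img_is_subgroup)
  show ?thesis
  proof (rule A.normal_invI[OF sg])
    fix f c assume f: "f \<in> carrier (AutoGroup H)" and c: "c \<in> Inn H"
    then obtain k where k: "k \<in> carrier H" and ck: "c = conj_on H (carrier H) k"
      by (auto simp: Inn_def)
    have fa: "f \<in> auto H" using f by (simp add: carrier_AutoGroup)
    then have fh: "f \<in> hom H H" by (simp add: auto_def)
    interpret f: group_hom H H f using fh by unfold_locales
    have ca: "c \<in> auto H" using conj_on_auto[OF nrm k] ck by simp
    have fka: "conj_on H (carrier H) (f k) \<in> auto H"
      using conj_on_auto[OF nrm, of "f k"] k by simp
    have "f \<otimes>\<^bsub>AutoGroup H\<^esub> c = conj_on H (carrier H) (f k) \<otimes>\<^bsub>AutoGroup H\<^esub> f"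
      unfolding mult_AutoGroup[OF fa ca] mult_AutoGroup[OF fka fa]
      using k by (auto simp: ck compose_def conj_on_def restrict_def)
    then have "f \<otimes>\<^bsub>AutoGroup H\<^esub> c \<otimes>\<^bsub>AutoGroup H\<^esub> inv\<^bsub>AutoGroup H\<^esub> f = conj_on H (carrier H) (f k)"
      using fka f A.r_inv[OF f] A.inv_closed[OF f]
        A.m_assoc[of "conj_on H (carrier H) (f k)" f "inv\<^bsub>AutoGroup H\<^esub> f"]
        A.r_one[of "conj_on H (carrier H) (f k)"]
      unfolding carrier_AutoGroup by metis
    then show "f \<otimes>\<^bsub>AutoGroup H\<^esub> c \<otimes>\<^bsub>AutoGroup H\<^esub> inv\<^bsub>AutoGroup H\<^esub> f \<in> Inn H"
      using k by (auto simp: Inn_def)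
  qed
qed

lemma coupling_eq:
  fixes G (structure)
  assumes "group G" "group Q" "\<pi> \<in> hom G Q" "kernel G Q \<pi> = K" "g \<in> carrier G"
  shows "coupling G K \<pi> (\<pi> g) =
    Inn (G\<lparr>carrier := K\<rparr>) #>\<^bsub>AutoGroup (G\<lparr>carrier := K\<rparr>)\<^esub> conj_on G K g"
proof -
  interpret p: group_hom G Q \<pi>
    using assms by (auto simp: group_hom_def group_hom_axioms_def)
  have nrm: "K \<lhd> G" using p.normal_kernel assms(4) by simp
  interpret normal K G by fact
  let ?H = "G\<lparr>carrier := K\<rparr>"
  have H: "group ?H" by (rule subgroup_is_group[OF p.G.is_group])
  interpret I: normal "Inn ?H" "AutoGroup ?H" by (rule Inn_normal[OF H])
  define h where "h = (SOME h. h \<in> carrier G \<and> \<pi> h = \<pi> g)"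
  have h: "h \<in> carrier G" "\<pi> h = \<pi> g"
    using someI[of "\<lambda>h. h \<in> carrier G \<and> \<pi> h = \<pi> g" g] assms(5) by (auto simp: h_def)
  have "h \<otimes> inv g \<in> K"
    using h assms(5) unfolding assms(4)[symmetric] kernel_def by simp
  moreover have "h = (h \<otimes> inv g) \<otimes> g"
    using h assms(5) by (simp add: p.G.m_assoc)
  ultimately obtain k where k: "k \<in> K" "h = k \<otimes> g" by blast
  have "conj_on G K h = conj_on G K k \<otimes>\<^bsub>AutoGroup ?H\<^esub> conj_on G K g"
    using conj_on_mult[OF nrm _ assms(5), of k] k by auto
  moreover have "conj_on G K k \<in> Inn ?H"
    using k by (simp add: Inn_subgroup_eq[OF nrm])
  ultimately have "conj_on G K h \<in> Inn ?H #>\<^bsub>AutoGroup ?H\<^esub> conj_on G K g"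
    by (auto simp: r_coset_def)
  then have "Inn ?H #>\<^bsub>AutoGroup ?H\<^esub> conj_on G K g = Inn ?H #>\<^bsub>AutoGroup ?H\<^esub> conj_on G K h"
    using I.repr_independence[OF _ _ I.subgroup_axioms] conj_on_auto[OF nrm assms(5)]
    by (simp add: carrier_AutoGroup)
  then show ?thesis by (simp add: coupling_def h_def)
qed

lemma coupling_hom:
  fixes G (structure)
  assumes "group G" "group Q" "\<pi> \<in> epi G Q" "kernel G Q \<pi> = K"
  shows "coupling G K \<pi> \<in> hom Q (Out (G\<lparr>carrier := K\<rparr>))"
proof -
  have hm: "\<pi> \<in> hom G Q" and sj: "\<pi> ` carrier G = carrier Q"
    using assms(3) by (auto simp: epi_def)
  interpret p: group_hom G Q \<pi>
    using assms hm by (auto simp: group_hom_def group_hom_axioms_def)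
  have nrm: "K \<lhd> G" using p.normal_kernel assms(4) by simp
  interpret normal K G by fact
  let ?H = "G\<lparr>carrier := K\<rparr>"
  have H: "group ?H" by (rule subgroup_is_group[OF p.G.is_group])
  interpret I: normal "Inn ?H" "AutoGroup ?H" by (rule Inn_normal[OF H])
  note eq = coupling_eq[OF assms(1,2) hm assms(4)]
  show ?thesis
  proof (rule homI)
    fix x assume "x \<in> carrier Q"
    then obtain g where "g \<in> carrier G" "x = \<pi> g" using sj by auto
    then show "coupling G K \<pi> x \<in> carrier (Out ?H)"
      using conj_on_auto[OF nrm] by (auto simp: eq Out_def carrier_FactGroup carrier_AutoGroup)
  next
    fix x y assume "x \<in> carrier Q" "y \<in> carrier Q"
    then obtain g h where gh: "g \<in> carrier G" "x = \<pi> g" "h \<in> carrier G" "y = \<pi> h"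
      using sj by (metis imageE)
    have "coupling G K \<pi> (\<pi> (g \<otimes> h)) = coupling G K \<pi> x \<otimes>\<^bsub>Out ?H\<^esub> coupling G K \<pi> y"
      using gh conj_on_auto[OF nrm]
      by (simp add: eq Out_def conj_on_mult[OF nrm] I.rcos_sum carrier_AutoGroup del: p.hom_mult)
    then show "coupling G K \<pi> (x \<otimes>\<^bsub>Q\<^esub> y) = coupling G K \<pi> x \<otimes>\<^bsub>Out ?H\<^esub> coupling G K \<pi> y"
      using gh by simp
  qed
qed

end

theory Submission
  imports Defs
begin

text \<open>If \<open>x\<close> has a finite conjugacy class in \<open>G\<close>, then so has every commutator \<open>[x, k]\<close>
  with \<open>k \<in> K\<close>. As \<open>[x, k]\<close> lies in \<open>K\<close>, it is trivial by (i); hence \<open>x\<close> centralizes \<open>K\<close>,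
  the class \<open>\<Theta> (\<pi> x)\<close> is trivial, and \<open>\<pi> x = 1\<close> by (ii), since \<open>\<pi> x \<in> FC(Q)\<close>. So \<open>x\<close> lies in
  \<open>FC\<^sub>G(K) = {1}\<close>. A finite \<open>G\<close> would thus be trivial.\<close>

text \<open>Conjugating \<open>[x, k]\<close> by \<open>g\<close> gives the conjugate of
  \<open>x\<close> by \<open>g\<close> times the inverse of the conjugate of \<open>x\<close> by
  \<open>g \<otimes> k\<close>. Hence its class lies in the image of a product of two finite
  sets.\<close>

lemma (in group) finite_conj_class_commutator:
  assumes fin: "finite (conj_class G x)" and x: "x \<in> carrier G" and k: "k \<in> carrier G"
  shows "finite (conj_class G (x \<otimes> k \<otimes> inv x \<otimes> inv k))"
proof -
  have "conj_class G (x \<otimes> k \<otimes> inv x \<otimes> inv k)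
      \<subseteq> (\<lambda>(a, b). a \<otimes> inv b) ` (conj_class G x \<times> conj_class G x)"
  proof
    fix y assume "y \<in> conj_class G (x \<otimes> k \<otimes> inv x \<otimes> inv k)"
    then obtain g where g: "g \<in> carrier G"
      and y: "y = g \<otimes> (x \<otimes> k \<otimes> inv x \<otimes> inv k) \<otimes> inv g"
      by (auto simp: conj_class_def)
    have cancel: "inv g \<otimes> (g \<otimes> z) = z" if "z \<in> carrier G" for z
      using g that by (simp flip: m_assoc)
    have "y = (g \<otimes> x \<otimes> inv g) \<otimes> inv (g \<otimes> k \<otimes> x \<otimes> inv (g \<otimes> k))"
      using x k g by (simp add: y m_assoc inv_mult_group cancel)
    moreover have "g \<otimes> x \<otimes> inv g \<in> conj_class G x"
        "g \<otimes> k \<otimes> x \<otimes> inv (g \<otimes> k) \<in> conj_class G x"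
      using k g unfolding conj_class_def by (blast intro: m_closed)+
    ultimately show "y \<in> (\<lambda>(a, b). a \<otimes> inv b) ` (conj_class G x \<times> conj_class G x)"
      by auto
  qed
  then show ?thesis
    by (rule finite_subset) (simp add: fin)
qed

lemma (in group) one_mem_FC: "\<one> \<in> FC G"
proof -
  have "conj_class G \<one> \<subseteq> {\<one>}"
    by (auto simp: conj_class_def)
  then show ?thesis
    by (auto simp: FC_def FC_in_def intro: finite_subset)
qed

text \<open>By surjectivity every conjugating element of \<open>H\<close> lifts to
  \<open>G\<close>.\<close>

lemma (in group_hom) conj_class_image:
  assumes "h ` carrier G = carrier H" "x \<in> carrier G"
  shows "conj_class H (h x) = h ` conj_class G x"
proof -
  have "conj_class H (h x) = (\<lambda>g. h g \<otimes>\<^bsub>H\<^esub> h x \<otimes>\<^bsub>H\<^esub> inv\<^bsub>H\<^esub> h g) ` carrier G"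
    unfolding conj_class_def assms(1)[symmetric] by (simp add: image_image)
  also have "\<dots> = h ` conj_class G x"
    unfolding conj_class_def image_image using assms(2) by (intro image_cong) auto
  finally show ?thesis .
qed

text \<open>Conjugation by \<open>x\<close> and by \<open>\<one>\<close> agree on \<open>K\<close>,
  and \<open>coupling_eq\<close> allows these two as preimages. Comparing with the value at
  \<open>\<one>\<close> suits the use of \<open>inj_on\<close>.\<close>

lemma coupling_centralizing_eq:
  fixes G (structure)
  assumes "group G" "group Q" "\<pi> \<in> hom G Q" "kernel G Q \<pi> = K" "x \<in> carrier G"
    and K: "K \<subseteq> carrier G" and comm: "\<And>k. k \<in> K \<Longrightarrow> x \<otimes> k = k \<otimes> x"
  shows "coupling G K \<pi> (\<pi> x) = coupling G K \<pi> \<one>\<^bsub>Q\<^esub>"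
proof -
  interpret p: group_hom G Q \<pi>
    using assms by (auto simp: group_hom_def group_hom_axioms_def)
  have "x \<otimes> k \<otimes> inv x = k" if "k \<in> K" for k
    using that assms(5) K by (auto simp: comm p.G.m_assoc)
  then have "conj_on G K x = conj_on G K \<one>"
    unfolding conj_on_def using K by (intro restrict_ext) auto
  then show ?thesis
    using coupling_eq[OF assms(1-5)] coupling_eq[OF assms(1-4) p.G.one_closed] by simp
qed

theorem proposition1p2:
  fixes G :: "('a, 'm) monoid_scheme" and Q :: "('q, 'n) monoid_scheme"
    and K :: "'a set" and \<pi> :: "'a \<Rightarrow> 'q"
  assumes "group G" and "carrier G \<noteq> {\<one>\<^bsub>G\<^esub>}" and "group Q"
    and "K \<lhd> G" and "\<pi> \<in> epi G Q" and "kernel G Q \<pi> = K"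
    and "FC_in G K = {\<one>\<^bsub>G\<^esub>}"
    and "inj_on (coupling G K \<pi>) (FC Q)"
  shows "icc G"
proof -
  have hm: "\<pi> \<in> hom G Q" and sj: "\<pi> ` carrier G = carrier Q"
    using assms(5) by (auto simp: epi_def)
  interpret p: group_hom G Q \<pi>
    using assms(1,3) hm by (auto simp: group_hom_def group_hom_axioms_def)
  interpret K: normal K G by fact
  note KG = K.mem_carrier
  have triv: "x = \<one>\<^bsub>G\<^esub>" if x: "x \<in> carrier G" and fin: "finite (conj_class G x)" for x
  proof -
    have comm: "x \<otimes>\<^bsub>G\<^esub> k = k \<otimes>\<^bsub>G\<^esub> x" if k: "k \<in> K" for k
    proof -
      let ?c = "x \<otimes>\<^bsub>G\<^esub> k \<otimes>\<^bsub>G\<^esub> inv\<^bsub>G\<^esub> x \<otimes>\<^bsub>G\<^esub> inv\<^bsub>G\<^esub> k"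
      \<comment> \<open>By normality \<open>K\<close> contains the conjugate of \<open>k\<close> by
        \<open>x\<close>, the first factor of \<open>?c\<close>.\<close>
      have "?c \<in> K"
        using k x by (simp add: K.inv_op_closed2)
      then have "?c \<in> FC_in G K"
        using p.G.finite_conj_class_commutator[OF fin x KG[OF k]] by (simp add: FC_in_def)
      then have "?c = \<one>\<^bsub>G\<^esub>"
        using assms(7) by simp
      \<comment> \<open>A left inverse of \<open>inv k\<close> must be \<open>k\<close>.\<close>
      then have "x \<otimes>\<^bsub>G\<^esub> k \<otimes>\<^bsub>G\<^esub> inv\<^bsub>G\<^esub> x = k"
        using x KG[OF k] p.G.inv_equality[of _ "inv\<^bsub>G\<^esub> k"] by fastforce
      then show ?thesis
        using x KG[OF k] by (metis p.G.inv_solve_right' p.G.m_closed)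
    qed
    have "\<pi> x \<in> FC Q"
      using fin x by (simp add: FC_def FC_in_def p.conj_class_image[OF sj x])
    moreover have "coupling G K \<pi> (\<pi> x) = coupling G K \<pi> \<one>\<^bsub>Q\<^esub>"
      by (rule coupling_centralizing_eq[OF assms(1,3) hm assms(6) x K.subset comm])
    \<comment> \<open>Injectivity applies because both \<open>\<pi> x\<close> and
      \<open>\<one>\<close> lie in \<open>FC Q\<close>.\<close>
    ultimately have "\<pi> x = \<one>\<^bsub>Q\<^esub>"
      using assms(8) p.H.one_mem_FC by (auto dest: inj_onD)
    then have "x \<in> FC_in G K"
      using x fin assms(6) by (auto simp: FC_in_def kernel_def)
    then show ?thesis
      using assms(7) by simp
  qed
  moreover have "infinite (carrier G)"
  proof
    assume "finite (carrier G)"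
    \<comment> \<open>Each class is an image of the carrier, hence finite here, so
      \<open>triv\<close> applies to every element.\<close>
    then have "carrier G \<subseteq> {\<one>\<^bsub>G\<^esub>}"
      using triv by (auto simp: conj_class_def)
    then show False
      using assms(2) by auto
  qed
  ultimately show ?thesis
    by (auto simp: icc_def)
qed

end
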